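(* For $\rho\ge0$ and $N_{\mathrm{mesh}}\ge1$, let $\widetilde{\mathbf{K}}_n^{(3,1)}(\rho)=-\widetilde{\mathbf{B}}_n^{(3,1)}+\rho\,\widetilde{\mathbf{M}}_n^{(3,1)}\in\mathbb{R}^{2N_{\mathrm{mesh}}\times2N_{\mathrm{mesh}}}$ be the matrix defined in the context, where $n=2N_{\mathrm{mesh}}+1$. If $$\rho\in(168/17,10)\cup(42,+\infty),$$ then the condition numbers of $\widetilde{\mathbf{K}}_n^{(3,1)}(\rho)$ grow at least exponentially as $n\to\infty$, i.e. there are $c,\alpha>0$, depending on $\rho$, with $\kappa(\widetilde{\mathbf{K}}_n^{(3,1)}(\rho))\ge c\,e^{\alpha n}$ for all $n$.
   Context: $\widetilde{\mathbf{M}}_n^{(3,1)}$ and $\widetilde{\mathbf{B}}_n^{(3,1)}$ are the $2N_{\mathrm{mesh}}\times2N_{\mathrm{mesh}}$ block Toeplitz band matrices $(M_{i-j})_{i,j=0}^{N_{\mathrm{mesh}}-1}$ and $(B_{i-j})_{i,j=0}^{N_{\mathrm{mesh}}-1}$ with $2\times2$ blocks $$M_{-1}=\tfrac1{560}\begin{pmatrix}1&0\\9&0\end{pmatrix},\ M_0=\tfrac1{560}\begin{pmatrix}80&9\\128&53\end{pmatrix},\ M_1=\tfrac1{560}\begin{pmatrix}53&128\\9&80\end{pmatrix},\ M_2=\tfrac1{560}\begin{pmatrix}0&9\\0&1\end{pmatrix},$$ $$B_{-1}=\tfrac3{40}\begin{pmatrix}-1&0\\-5&0\end{pmatrix},\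 B_0=\tfrac3{40}\begin{pmatrix}0&-5\\16&-5\end{pmatrix},\ B_1=\tfrac3{40}\begin{pmatrix}-5&16\\-5&0\end{pmatrix},\ B_2=\tfrac3{40}\begin{pmatrix}0&-5\\0&-1\end{pmatrix},$$ all other blocks being zero. (They are the pure block Toeplitz versions of the scaled mass and stiffness matrices of cubic $C^1$ B-splines on a uniform mesh with $N_{\mathrm{mesh}}$ elements.) $\kappa(M)=\|M\|\,\|M^{-1}\|$ in the spectral norm, with $\kappa(M)=\infty$ if $M$ is singular. *)

theory Defs
  imports
    "Jordan_Normal_Form.Gauss_Jordan_Elimination"
    "HOL-Library.Extended_Real"
begin

definition vec_norm2 :: "real vec \<Rightarrow> real" where
  "vec_norm2 v = sqrt (v \<bullet> v)"

definition spectral_norm :: "real mat \<Rightarrow> real" where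
  "spectral_norm A = Sup {vec_norm2 (A *\<^sub>v v) | v. v \<in> carrier_vec (dim_col A) \<and> vec_norm2 v \<le> 1}"

definition condition_number :: "real mat \<Rightarrow> ereal" where
  "condition_number A = (case mat_inverse A of
      None \<Rightarrow> \<infinity>
    | Some A' \<Rightarrow> ereal (spectral_norm A * spectral_norm A'))"

text \<open>The \<open>N \<times> N\<close> block Toeplitz matrix whose \<open>2 \<times> 2\<close> block in block position \<open>(i, j)\<close> is
  \<open>T (i - j)\<close>. The difference is taken in the integers.\<close>

definition block_toeplitz2 :: "(int \<Rightarrow> real mat) \<Rightarrow> nat \<Rightarrow> real mat" where
  "block_toeplitz2 T N = mat (2 * N) (2 * N)
     (\<lambda>(r, s). T (int (r div 2) - int (s div 2)) $$ (r mod 2, s mod 2))"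

definition mass_block :: "int \<Rightarrow> real mat" where
  "mass_block k = (1 / 560) \<cdot>\<^sub>m
    (if k = - 1 then mat_of_rows_list 2 [[1, 0], [9, 0]]
     else if k = 0 then mat_of_rows_list 2 [[80, 9], [128, 53]]
     else if k = 1 then mat_of_rows_list 2 [[53, 128], [9, 80]]
     else if k = 2 then mat_of_rows_list 2 [[0, 9], [0, 1]]
     else 0\<^sub>m 2 2)"

definition stiffness_block :: "int \<Rightarrow> real mat" where
  "stiffness_block k = (3 / 40) \<cdot>\<^sub>m
    (if k = - 1 then mat_of_rows_list 2 [[- 1, 0], [- 5, 0]]
     else if k = 0 then mat_of_rows_list 2 [[0, - 5], [16, - 5]]
     else if k = 1 then mat_of_rows_list 2 [[- 5, 16], [- 5, 0]]
     else if k = 2 then mat_of_rows_list 2 [[0, - 5], [0, - 1]]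
     else 0\<^sub>m 2 2)"

text \<open>The matrices below are indexed by the number \<open>N\<close> of mesh elements, so the subscript
  \<open>n\<close> of the mathematical notation is \<open>2 * N + 1\<close>.\<close>

definition mass_mat :: "nat \<Rightarrow> real mat" where
  "mass_mat N = block_toeplitz2 mass_block N"

definition stiffness_mat :: "nat \<Rightarrow> real mat" where
  "stiffness_mat N = block_toeplitz2 stiffness_block N"

definition system_mat :: "nat \<Rightarrow> real \<Rightarrow> real mat" where
  "system_mat N \<rho> = - stiffness_mat N + \<rho> \<cdot>\<^sub>m mass_mat N"

end

theory Submission
  imports Defs "HOL-Analysis.L2_Norm"
begin

text \<open>Write \<open>K k\<close> for the blocks of the system matrix and \<open>F w = \<Sum>k. K k w ^ k\<close> for its symbol.
  Up to a power of \<open>w\<close>, \<open>det (F w)\<close> is a palindromic polynomial of degree four in \<open>w\<close>. For the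
  given \<open>\<rho>\<close> it has two roots inside and two outside the unit circle, while \<open>det (F w)\<close> itself has a
  simple pole at zero. So its winding number around the origin is one, and the semi-infinite Toeplitz
  operator has nonzero index: its transpose has a kernel.

  The proof makes that kernel explicit. The roots \<open>w1\<close>, \<open>w2\<close> in the open disc turn out to be real and
  distinct (\<open>symbol_determinant_roots\<close>, by the intermediate value theorem). With null vectors
  \<open>v\<close>, \<open>u\<close> of the transposed symbol at the two roots, the sequences
  \<open>A w1 ^ j v + B w2 ^ j u\<close> satisfy the left null recursion away from the boundary; the boundary costs
  a single linear condition on \<open>(A, B)\<close>, so a nonzero decaying left null sequence remains
  (\<open>decaying_left_null_sequence\<close>).

  Cut off after \<open>N\<close> blocks, this sequence is a vector \<open>y\<close> of norm bounded below with
  \<open>\<parallel>K\<^sup>T y\<parallel> = O(r ^ N)\<close> for some \<open>r < 1\<close> (\<open>left_residual_le\<close>). Hence \<open>\<parallel>K\<^sup>-\<^sup>1\<parallel>\<close> is at least a multiple of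
  \<open>r ^ - N\<close>, whereas \<open>\<parallel>K\<parallel>\<close> is bounded below by any fixed entry
  (\<open>condition_number_ge_left_residual\<close>).\<close>

section \<open>Spectral norm and condition number\<close>

lemma vec_norm2_eq_L2_set: "vec_norm2 v = L2_set (\<lambda>i. v $ i) {..<dim_vec v}"
  by (simp add: vec_norm2_def L2_set_def scalar_prod_def power2_eq_square lessThan_atLeast0)

lemma vec_norm2_nonneg [simp]: "vec_norm2 v \<ge> 0"
  by (simp add: vec_norm2_eq_L2_set)

lemma vec_norm2_square: "(vec_norm2 v)\<^sup>2 = v \<bullet> v"
  by (simp add: vec_norm2_def scalar_prod_def sum_nonneg)

lemma vec_norm2_smult: "vec_norm2 (c \<cdot>\<^sub>v v) = \<bar>c\<bar> * vec_norm2 v"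
proof -
  have "(c \<cdot>\<^sub>v v) \<bullet> (c \<cdot>\<^sub>v v) = c\<^sup>2 * (v \<bullet> v)"
    by (simp add: scalar_prod_def sum_distrib_left power2_eq_square mult_ac)
  then show ?thesis
    by (simp add: vec_norm2_def real_sqrt_mult)
qed

lemma abs_index_le_vec_norm2:
  assumes "i < dim_vec v"
  shows "\<bar>v $ i\<bar> \<le> vec_norm2 v"
proof -
  have "\<bar>v $ i\<bar> \<le> L2_set (\<lambda>i. \<bar>v $ i\<bar>) {..<dim_vec v}"
    using assms by (intro member_le_L2_set) auto
  then show ?thesis
    by (simp add: vec_norm2_eq_L2_set L2_set_def)
qed

lemma vec_norm2_le_sum_abs: "vec_norm2 v \<le> (\<Sum>i<dim_vec v. \<bar>v $ i\<bar>)"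
  by (simp add: vec_norm2_eq_L2_set L2_set_le_sum_abs)

lemma abs_scalar_prod_le:
  assumes "dim_vec u = dim_vec v"
  shows "\<bar>u \<bullet> v\<bar> \<le> vec_norm2 u * vec_norm2 v"
proof -
  have "\<bar>u \<bullet> v\<bar> \<le> (\<Sum>i<dim_vec v. \<bar>u $ i\<bar> * \<bar>v $ i\<bar>)"
    unfolding scalar_prod_def lessThan_atLeast0 abs_mult[symmetric] by (rule sum_abs)
  also have "\<dots> \<le> vec_norm2 u * vec_norm2 v"
    using L2_set_mult_ineq assms by (metis vec_norm2_eq_L2_set)
  finally show ?thesis .
qed

text \<open>By Cauchy--Schwarz in each row, the set whose supremum is the spectral norm is bounded;
  without this the supremum would be meaningless.\<close>

lemma bdd_above_spectral_norm:
  "bdd_above {vec_norm2 (A *\<^sub>v v) | v. v \<in> carrier_vec (dim_col A) \<and> vec_norm2 v \<le> 1}"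
proof (rule bdd_aboveI, clarify)
  fix v :: "real vec"
  assume v: "v \<in> carrier_vec (dim_col A)" "vec_norm2 v \<le> 1"
  have "vec_norm2 (A *\<^sub>v v) \<le> (\<Sum>i<dim_row A. \<bar>row A i \<bullet> v\<bar>)"
    using vec_norm2_le_sum_abs[of "A *\<^sub>v v"] by simp
  also have "\<dots> \<le> (\<Sum>i<dim_row A. vec_norm2 (row A i))"
  proof (rule sum_mono)
    fix i
    have "\<bar>row A i \<bullet> v\<bar> \<le> vec_norm2 (row A i) * vec_norm2 v"
      using v by (intro abs_scalar_prod_le) simp
    also have "\<dots> \<le> vec_norm2 (row A i)"
      using v by (simp add: mult_left_le)
    finally show "\<bar>row A i \<bullet> v\<bar> \<le> vec_norm2 (row A i)" .
  qed
  finally show "vec_norm2 (A *\<^sub>v v) \<le> (\<Sum>i<dim_row A. vec_norm2 (row A i))" .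
qed

lemma vec_norm2_mult_le_spectral_norm:
  assumes "v \<in> carrier_vec (dim_col A)"
  shows "vec_norm2 (A *\<^sub>v v) \<le> spectral_norm A * vec_norm2 v"
proof (cases "vec_norm2 v = 0")
  case True
  have "vec_norm2 (A *\<^sub>v v) \<le> (\<Sum>i<dim_row A. \<bar>row A i \<bullet> v\<bar>)"
    using vec_norm2_le_sum_abs[of "A *\<^sub>v v"] by simp
  also have "\<dots> \<le> (\<Sum>i<dim_row A. vec_norm2 (row A i) * vec_norm2 v)"
    using assms by (intro sum_mono abs_scalar_prod_le) simp
  finally show ?thesis
    using True by simp
next
  case False
  then have pos: "vec_norm2 v > 0"
    using vec_norm2_nonneg[of v] by linarith
  let ?u = "inverse (vec_norm2 v) \<cdot>\<^sub>v v"
  have "vec_norm2 (A *\<^sub>v ?u) \<le> spectral_norm A"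
    unfolding spectral_norm_def
    using pos assms
    by (intro cSup_upper bdd_above_spectral_norm) (auto simp: vec_norm2_smult intro!: exI[of _ ?u])
  moreover have "A *\<^sub>v ?u = inverse (vec_norm2 v) \<cdot>\<^sub>v (A *\<^sub>v v)"
    using assms by (intro mult_mat_vec) auto
  ultimately show ?thesis
    using pos by (simp add: vec_norm2_smult field_simps)
qed

lemma abs_entry_le_spectral_norm:
  assumes "i < dim_row A" "j < dim_col A"
  shows "\<bar>A $$ (i, j)\<bar> \<le> spectral_norm A"
proof -
  let ?e = "unit_vec (dim_col A) j :: real vec"
  have "A $$ (i, j) = (A *\<^sub>v ?e) $ i"
    using assms by simp
  also have "\<bar>\<dots>\<bar> \<le> vec_norm2 (A *\<^sub>v ?e)"
    using assms by (intro abs_index_le_vec_norm2) simp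
  also have "\<dots> \<le> spectral_norm A * vec_norm2 ?e"
    by (rule vec_norm2_mult_le_spectral_norm) simp
  also have "vec_norm2 ?e = 1"
    using assms by (simp add: vec_norm2_def)
  finally show ?thesis
    by simp
qed

text \<open>An approximate left null vector \<open>y\<close> makes the inverse large:
  \<open>y \<bullet> y = (A\<^sup>T y) \<bullet> (A\<^sup>-\<^sup>1 y)\<close>, so Cauchy--Schwarz gives \<open>\<parallel>y\<parallel> \<le> \<parallel>A\<^sup>T y\<parallel> \<parallel>A\<^sup>-\<^sup>1\<parallel>\<close>. Working from
  the left avoids comparing the norms of \<open>A\<^sup>-\<^sup>1\<close> and its transpose.\<close>

lemma condition_number_ge_left_residual:
  assumes A: "A \<in> carrier_mat n n" and y: "y \<in> carrier_vec n"
    and ij: "i < n" "j < n"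
    and res: "vec_norm2 (transpose_mat A *\<^sub>v y) \<le> \<delta>" and \<delta>: "\<delta> > 0"
  shows "condition_number A \<ge> ereal (\<bar>A $$ (i, j)\<bar> * (vec_norm2 y / \<delta>))"
proof (cases "mat_inverse A")
  case None
  then show ?thesis
    by (simp add: condition_number_def)
next
  case (Some B)
  from mat_inverse(2)[OF A Some] have B: "A * B = 1\<^sub>m n" "B \<in> carrier_mat n n"
    by auto
  have By: "B *\<^sub>v y \<in> carrier_vec n"
    using B y by auto
  have entry: "\<bar>A $$ (i, j)\<bar> \<le> spectral_norm A"
    using A ij by (intro abs_entry_le_spectral_norm) auto
  have Bnorm: "vec_norm2 (B *\<^sub>v y) \<le> spectral_norm B * vec_norm2 y"
    using B y by (intro vec_norm2_mult_le_spectral_norm) auto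
  have "(vec_norm2 y)\<^sup>2 = y \<bullet> (A *\<^sub>v (B *\<^sub>v y))"
    using A B y assoc_mult_mat_vec[OF A B(2) y] by (simp add: vec_norm2_square)
  also have "\<dots> = (transpose_mat A *\<^sub>v y) \<bullet> (B *\<^sub>v y)"
    using transpose_vec_mult_scalar[OF A By y] by simp
  also have "\<dots> \<le> vec_norm2 (transpose_mat A *\<^sub>v y) * vec_norm2 (B *\<^sub>v y)"
    using A B abs_scalar_prod_le[of "transpose_mat A *\<^sub>v y" "B *\<^sub>v y"] by auto
  also have "\<dots> \<le> \<delta> * (spectral_norm B * vec_norm2 y)"
    using res \<delta> Bnorm by (intro mult_mono) auto
  finally have sq: "vec_norm2 y * vec_norm2 y \<le> (\<delta> * spectral_norm B) * vec_norm2 y"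
    by (simp add: power2_eq_square mult_ac)
  have "0 \<le> \<bar>B $$ (i, j)\<bar>"
    by simp
  also have "\<dots> \<le> spectral_norm B"
    using B ij by (intro abs_entry_le_spectral_norm) auto
  finally have B0: "spectral_norm B \<ge> 0" .
  have "vec_norm2 y \<le> \<delta> * spectral_norm B"
  proof (cases "vec_norm2 y = 0")
    case True
    then show ?thesis
      using \<delta> B0 by simp
  next
    case False
    then show ?thesis
      using sq vec_norm2_nonneg[of y] by (simp add: mult_le_cancel_right)
  qed
  then have "vec_norm2 y / \<delta> \<le> spectral_norm B"
    using \<delta> by (simp add: field_simps)
  then have "\<bar>A $$ (i, j)\<bar> * (vec_norm2 y / \<delta>) \<le> spectral_norm A * spectral_norm B"
    using entry \<delta> by (intro mult_mono) (auto intro: order_trans[OF abs_ge_zero])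
  then show ?thesis
    using Some by (simp add: condition_number_def)
qed


section \<open>Block Toeplitz matrices with a decaying left null sequence\<close>

lemma sum_pairs: "(\<Sum>r<2 * N. f r) = (\<Sum>i<N. \<Sum>p<2. f (2 * i + p))" for f :: "nat \<Rightarrow> real"
  by (induction N) (auto simp: numeral_2_eq_2)

lemma block_toeplitz2_carrier [simp]: "block_toeplitz2 T N \<in> carrier_mat (2 * N) (2 * N)"
  by (simp add: block_toeplitz2_def)

lemma transpose_block_toeplitz2_mult_vec:
  assumes "s < 2 * N"
  shows "(transpose_mat (block_toeplitz2 T N) *\<^sub>v vec (2 * N) (\<lambda>r. Y (r div 2) (r mod 2))) $ s =
    (\<Sum>i<N. \<Sum>p<2. T (int i - int (s div 2)) $$ (p, s mod 2) * Y i p)"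
proof -
  have "(transpose_mat (block_toeplitz2 T N) *\<^sub>v vec (2 * N) (\<lambda>r. Y (r div 2) (r mod 2))) $ s =
    (\<Sum>r<2 * N. T (int (r div 2) - int (s div 2)) $$ (r mod 2, s mod 2) * Y (r div 2) (r mod 2))"
    using assms by (simp add: block_toeplitz2_def scalar_prod_def lessThan_atLeast0)
  then show ?thesis
    unfolding sum_pairs by simp
qed

text \<open>A left null sequence of the semi-infinite matrix, cut off after \<open>N\<close> blocks, misses in column
  \<open>j\<close> only the terms from the blocks \<open>N\<close> and \<open>N + 1\<close>. These are of size \<open>r ^ N\<close>, and by the band
  structure they are present only in the last four columns.\<close>

lemma left_residual_le:
  fixes T :: "int \<Rightarrow> real mat" and Y :: "nat \<Rightarrow> nat \<Rightarrow> real"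
  assumes band: "\<And>k p q. k > 2 \<Longrightarrow> p < 2 \<Longrightarrow> q < 2 \<Longrightarrow> T k $$ (p, q) = 0"
    and bound: "\<And>k p q. p < 2 \<Longrightarrow> q < 2 \<Longrightarrow> \<bar>T k $$ (p, q)\<bar> \<le> C"
    and null: "\<And>j q. q < 2 \<Longrightarrow> (\<Sum>i<j + 3. \<Sum>p<2. T (int i - int j) $$ (p, q) * Y i p) = 0"
    and decay: "\<And>i p. p < 2 \<Longrightarrow> \<bar>Y i p\<bar> \<le> D * r ^ i"
    and r: "0 < r" "r < 1"
  shows "vec_norm2 (transpose_mat (block_toeplitz2 T N) *\<^sub>v
      vec (2 * N) (\<lambda>r. Y (r div 2) (r mod 2))) \<le> 16 * C * D * r ^ N"
proof -
  let ?R = "transpose_mat (block_toeplitz2 T N) *\<^sub>v vec (2 * N) (\<lambda>r. Y (r div 2) (r mod 2))"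
  define \<phi> where "\<phi> j q i = (\<Sum>p<2. T (int i - int j) $$ (p, q) * Y i p)" for j q i
  have "0 \<le> \<bar>T 0 $$ (0, 0)\<bar>" "\<bar>T 0 $$ (0, 0)\<bar> \<le> C"
    using bound[of 0 0 0] by auto
  then have C: "0 \<le> C"
    by linarith
  have D: "0 \<le> D"
    using decay[of 0 0] by simp
  have \<phi>_zero: "\<phi> j q i = 0" if "i > j + 2" "q < 2" for i j q
    unfolding \<phi>_def using that by (intro sum.neutral) (auto intro!: disjI1 band)
  have \<phi>_le: "\<bar>\<phi> j q i\<bar> \<le> 2 * C * D * r ^ N" if "N \<le> i" "q < 2" for i j q
  proof -
    have "\<bar>\<phi> j q i\<bar> \<le> (\<Sum>p<2. \<bar>T (int i - int j) $$ (p, q)\<bar> * \<bar>Y i p\<bar>)"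
      unfolding \<phi>_def abs_mult[symmetric] by (rule sum_abs)
    also have "\<dots> \<le> (\<Sum>p<(2::nat). C * (D * r ^ N))"
    proof (intro sum_mono mult_mono bound)
      fix p :: nat
      assume p: "p \<in> {..<2}"
      have "\<bar>Y i p\<bar> \<le> D * r ^ i"
        using decay p by simp
      also have "\<dots> \<le> D * r ^ N"
        using D r that by (intro mult_left_mono power_decreasing) auto
      finally show "\<bar>Y i p\<bar> \<le> D * r ^ N" .
    qed (use C that in auto)
    finally show ?thesis
      by simp
  qed
  have R: "?R $ s = (\<Sum>i<N. \<phi> (s div 2) (s mod 2) i)" if "s < 2 * N" for s
    unfolding \<phi>_def using that by (rule transpose_block_toeplitz2_mult_vec)
  have sum_\<phi>: "(\<Sum>i<N. \<phi> j q i) = - \<phi> j q N - \<phi> j q (N + 1)" if "j < N" "q < 2" for j q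
  proof -
    have "(\<Sum>i<N + 2. \<phi> j q i) = (\<Sum>i<j + 3. \<phi> j q i)"
      using that by (intro sum.mono_neutral_right) (auto intro: \<phi>_zero)
    also have "\<dots> = 0"
      unfolding \<phi>_def using that(2) by (rule null)
    finally show ?thesis
      by simp
  qed
  have R_zero: "?R $ s = 0" if "s < 2 * N - 4" for s
    using that R[of s] sum_\<phi>[of "s div 2" "s mod 2"] by (simp add: \<phi>_zero)
  have R_le: "\<bar>?R $ s\<bar> \<le> 4 * C * D * r ^ N" if "s < 2 * N" for s
  proof -
    let ?j = "s div 2" and ?q = "s mod 2"
    have "?R $ s = - \<phi> ?j ?q N - \<phi> ?j ?q (N + 1)"
      using that R[of s] sum_\<phi>[of ?j ?q] by simp
    moreover have "\<bar>\<phi> ?j ?q N\<bar> \<le> 2 * C * D * r ^ N" "\<bar>\<phi> ?j ?q (N + 1)\<bar> \<le> 2 * C * D * r ^ N"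
      by (auto intro: \<phi>_le)
    ultimately show ?thesis
      by linarith
  qed
  have "vec_norm2 ?R \<le> (\<Sum>s<2 * N. \<bar>?R $ s\<bar>)"
    using vec_norm2_le_sum_abs[of ?R] by (simp add: block_toeplitz2_def)
  also have "\<dots> = (\<Sum>s\<in>{2 * N - 4..<2 * N}. \<bar>?R $ s\<bar>)"
    using R_zero by (intro sum.mono_neutral_right) auto
  also have "\<dots> \<le> (\<Sum>s\<in>{2 * N - 4..<2 * N}. 4 * C * D * r ^ N)"
    by (intro sum_mono R_le) auto
  also have "\<dots> = real (card {2 * N - 4..<2 * N}) * (4 * C * D * r ^ N)"
    by simp
  also have "\<dots> \<le> 4 * (4 * C * D * r ^ N)"
    using C D r by (intro mult_right_mono) auto
  finally show ?thesis
    by simp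
qed

text \<open>The norm of the matrix is bounded below by its first diagonal entry and that of the cut-off null
  sequence by its entry \<open>Y 0 p0\<close>, both independent of \<open>N\<close>; the residual decays like \<open>r ^ N\<close>.\<close>

theorem condition_number_block_toeplitz2_exp_growth:
  fixes T :: "int \<Rightarrow> real mat" and Y :: "nat \<Rightarrow> nat \<Rightarrow> real"
  assumes band: "\<And>k p q. k > 2 \<Longrightarrow> p < 2 \<Longrightarrow> q < 2 \<Longrightarrow> T k $$ (p, q) = 0"
    and bound: "\<And>k p q. p < 2 \<Longrightarrow> q < 2 \<Longrightarrow> \<bar>T k $$ (p, q)\<bar> \<le> C"
    and null: "\<And>j q. q < 2 \<Longrightarrow> (\<Sum>i<j + 3. \<Sum>p<2. T (int i - int j) $$ (p, q) * Y i p) = 0"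
    and decay: "\<And>i p. p < 2 \<Longrightarrow> \<bar>Y i p\<bar> \<le> D * r ^ i"
    and r: "0 < r" "r < 1"
    and diag: "T 0 $$ (0, 0) \<noteq> 0" and start: "p0 < 2" "Y 0 p0 \<noteq> 0"
  shows "\<exists>c \<alpha>. c > 0 \<and> \<alpha> > 0 \<and>
    (\<forall>N\<ge>1. condition_number (block_toeplitz2 T N) \<ge> ereal (c * exp (\<alpha> * real (2 * N + 1))))"
proof -
  define t \<eta> where "t = \<bar>T 0 $$ (0, 0)\<bar>" and "\<eta> = \<bar>Y 0 p0\<bar>"
  have pos: "t > 0" "\<eta> > 0" "C > 0" "D > 0"
    using diag start bound[of 0 0 0] decay[of p0 0] by (auto simp: t_def \<eta>_def)
  \<comment> \<open>The rate is halved because \<open>2 * N + 1\<close> grows by two per block; the factor \<open>exp \<alpha>\<close> in \<open>c\<close>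
    absorbs the summand 1.\<close>
  define \<alpha> where "\<alpha> = - ln r / 2"
  define c where "c = t * \<eta> / (16 * C * D * exp \<alpha>)"
  have "c * exp (\<alpha> * real (2 * N + 1)) \<le> t * (\<eta> / (16 * C * D * r ^ N))" for N
  proof -
    have "r ^ N = exp (- (\<alpha> * real (2 * N)))"
      using r by (simp add: \<alpha>_def exp_of_nat2_mult)
    then have "exp (\<alpha> * real (2 * N)) = 1 / r ^ N"
      by (simp add: exp_minus divide_inverse)
    moreover have "exp (\<alpha> * real (2 * N + 1)) = exp \<alpha> * exp (\<alpha> * real (2 * N))"
      by (simp add: exp_add[symmetric] algebra_simps)
    ultimately have "exp (\<alpha> * real (2 * N + 1)) = exp \<alpha> / r ^ N"
      by simp
    then show ?thesis
      by (simp add: c_def)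
  qed
  moreover have "condition_number (block_toeplitz2 T N) \<ge> ereal (t * (\<eta> / (16 * C * D * r ^ N)))"
    if N: "N \<ge> 1" for N
  proof -
    let ?y = "vec (2 * N) (\<lambda>r. Y (r div 2) (r mod 2))"
    have "?y $ p0 = Y 0 p0"
      using N start by simp
    then have \<eta>: "\<eta> \<le> vec_norm2 ?y"
      using abs_index_le_vec_norm2[of p0 ?y] N start by (simp add: \<eta>_def)
    have entry: "\<bar>block_toeplitz2 T N $$ (0, 0)\<bar> = t"
      using N by (simp add: block_toeplitz2_def t_def)
    have "t * (\<eta> / (16 * C * D * r ^ N)) \<le> t * (vec_norm2 ?y / (16 * C * D * r ^ N))"
      using \<eta> pos r by (intro mult_left_mono divide_right_mono) auto
    then have "ereal (t * (\<eta> / (16 * C * D * r ^ N))) \<le>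
        ereal (t * (vec_norm2 ?y / (16 * C * D * r ^ N)))"
      by (rule iffD2[OF ereal_less_eq(3)])
    also have "\<dots> \<le> condition_number (block_toeplitz2 T N)"
      unfolding entry[symmetric]
      using N pos r left_residual_le[where T = T and Y = Y and N = N, OF band bound null decay r]
      by (intro condition_number_ge_left_residual[where n = "2 * N"]) auto
    finally show ?thesis .
  qed
  moreover have "c > 0" "\<alpha> > 0"
    using pos r by (auto simp: c_def \<alpha>_def)
  ultimately show ?thesis
    by (meson ereal_less_eq(3) order_trans)
qed


section \<open>The symbol and its modes inside the unit disc\<close>

text \<open>With suitable \<open>a\<close>, \<open>b\<close>, \<open>c\<close>, \<open>d\<close>, \<open>e\<close>, this is \<open>w\<close> times the determinant of 560 times the
  symbol \<open>\<Sum>k. K k w ^ k\<close> of the system matrix. The factors are, up to powers of \<open>w\<close>, the four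
  entries of that matrix.\<close>

definition symbol_det :: "real \<Rightarrow> real \<Rightarrow> real \<Rightarrow> real \<Rightarrow> real \<Rightarrow> real \<Rightarrow> real" where
  "symbol_det a b c d e w =
    (e + d * w + b * w\<^sup>2) * (b + d * w + e * w\<^sup>2) - (a + c * w + a * w\<^sup>2)\<^sup>2"

lemma symmetric_singular_kernel:
  fixes p q q' :: real
  assumes "q * q' = p\<^sup>2"
  obtains v u where "v \<noteq> 0 \<or> u \<noteq> 0" "q * v + p * u = 0" "p * v + q' * u = 0"
proof (cases "p = 0 \<and> q = 0")
  case True
  then show ?thesis
    using that[of 1 0] by simp
next
  case False
  moreover have "p * p + q' * - q = 0"
    using assms by (simp add: power2_eq_square mult.commute[of q'])
  ultimately show ?thesis
    using that[of p "- q"] by auto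
qed

text \<open>In the next lemma \<open>(x j, y j)\<close> is the \<open>j\<close>-th block of a left null sequence. The two roots
  \<open>w1\<close>, \<open>w2\<close> of the determinant of the symbol give a two-dimensional space of decaying sequences
  that satisfy the recursion. Only one boundary condition has to be met at the first block column,
  formally \<open>e * x (-1) + a * y (-1) = 0\<close> for the continued sequence, because the second column of the
  block with index \<open>- 1\<close> vanishes. Two dimensions minus one condition leave a nonzero solution.\<close>

lemma decaying_left_null_sequence:
  fixes a b c d e w1 w2 :: real
  assumes root: "symbol_det a b c d e w1 = 0" "symbol_det a b c d e w2 = 0"
    and w: "w1 \<noteq> w2" "w1 \<noteq> 0" "w2 \<noteq> 0" "\<bar>w1\<bar> < 1" "\<bar>w2\<bar> < 1"
  obtains x y :: "nat \<Rightarrow> real" and D r :: real where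
    "d * x 0 + c * y 0 + b * x 1 + a * y 1 = 0"
    "\<And>j. e * x j + a * y j + d * x (j + 1) + c * y (j + 1) + b * x (j + 2) + a * y (j + 2) = 0"
    "\<And>j. a * x j + b * y j + c * x (j + 1) + d * y (j + 1) + a * x (j + 2) + e * y (j + 2) = 0"
    "\<And>j. \<bar>x j\<bar> \<le> D * r ^ j" "\<And>j. \<bar>y j\<bar> \<le> D * r ^ j"
    "0 < r" "r < 1" "x 0 \<noteq> 0 \<or> y 0 \<noteq> 0"
proof -
  obtain v1 u1 where m1: "v1 \<noteq> 0 \<or> u1 \<noteq> 0"
    "(e + d * w1 + b * w1\<^sup>2) * v1 + (a + c * w1 + a * w1\<^sup>2) * u1 = 0"
    "(a + c * w1 + a * w1\<^sup>2) * v1 + (b + d * w1 + e * w1\<^sup>2) * u1 = 0"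
    using symmetric_singular_kernel root(1) unfolding symbol_det_def by (metis eq_iff_diff_eq_0)
  obtain v2 u2 where m2: "v2 \<noteq> 0 \<or> u2 \<noteq> 0"
    "(e + d * w2 + b * w2\<^sup>2) * v2 + (a + c * w2 + a * w2\<^sup>2) * u2 = 0"
    "(a + c * w2 + a * w2\<^sup>2) * v2 + (b + d * w2 + e * w2\<^sup>2) * u2 = 0"
    using symmetric_singular_kernel root(2) unfolding symbol_det_def by (metis eq_iff_diff_eq_0)
  define s1 s2 where "s1 = d * v1 + c * u1 + w1 * (b * v1 + a * u1)"
    and "s2 = d * v2 + c * u2 + w2 * (b * v2 + a * u2)"
  obtain A B where AB: "A \<noteq> 0 \<or> B \<noteq> 0" "A * s1 + B * s2 = 0"
  proof (cases "s1 = 0 \<and> s2 = 0")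
    case True
    then show ?thesis
      using that[of 1 0] by simp
  next
    case False
    then show ?thesis
      using that[of s2 "- s1"] by auto
  qed
  define x where "x j = A * v1 * w1 ^ j + B * v2 * w2 ^ j" for j :: nat
  define y where "y j = A * u1 * w1 ^ j + B * u2 * w2 ^ j" for j :: nat
  have bnd: "d * x 0 + c * y 0 + b * x 1 + a * y 1 = 0"
  proof -
    have "d * x 0 + c * y 0 + b * x 1 + a * y 1 = A * s1 + B * s2"
      by (simp add: x_def y_def s1_def s2_def algebra_simps)
    then show ?thesis
      using AB by simp
  qed
  have rec1: "e * x j + a * y j + d * x (j + 1) + c * y (j + 1) + b * x (j + 2) + a * y (j + 2) = 0"
    for j
  proof -
    have "e * x j + a * y j + d * x (j + 1) + c * y (j + 1) + b * x (j + 2) + a * y (j + 2) =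
      A * w1 ^ j * ((e + d * w1 + b * w1\<^sup>2) * v1 + (a + c * w1 + a * w1\<^sup>2) * u1) +
      B * w2 ^ j * ((e + d * w2 + b * w2\<^sup>2) * v2 + (a + c * w2 + a * w2\<^sup>2) * u2)"
      by (simp add: x_def y_def power2_eq_square algebra_simps)
    then show ?thesis
      by (simp add: m1 m2)
  qed
  have rec2: "a * x j + b * y j + c * x (j + 1) + d * y (j + 1) + a * x (j + 2) + e * y (j + 2) = 0"
    for j
  proof -
    have "a * x j + b * y j + c * x (j + 1) + d * y (j + 1) + a * x (j + 2) + e * y (j + 2) =
      A * w1 ^ j * ((a + c * w1 + a * w1\<^sup>2) * v1 + (b + d * w1 + e * w1\<^sup>2) * u1) +
      B * w2 ^ j * ((a + c * w2 + a * w2\<^sup>2) * v2 + (b + d * w2 + e * w2\<^sup>2) * u2)"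
      by (simp add: x_def y_def power2_eq_square algebra_simps)
    then show ?thesis
      by (simp add: m1 m2)
  qed
  define r where "r = max \<bar>w1\<bar> \<bar>w2\<bar>"
  define D where "D = \<bar>A * v1\<bar> + \<bar>B * v2\<bar> + \<bar>A * u1\<bar> + \<bar>B * u2\<bar>"
  have r: "0 < r" "r < 1"
    using w by (auto simp: r_def)
  have mode_le: "\<bar>k * w1 ^ j + l * w2 ^ j\<bar> \<le> (\<bar>k\<bar> + \<bar>l\<bar>) * r ^ j" for k l :: real and j
  proof -
    have "\<bar>k * w1 ^ j + l * w2 ^ j\<bar> \<le> \<bar>k\<bar> * \<bar>w1\<bar> ^ j + \<bar>l\<bar> * \<bar>w2\<bar> ^ j"
      by (metis abs_mult abs_triangle_ineq power_abs)
    also have "\<dots> \<le> \<bar>k\<bar> * r ^ j + \<bar>l\<bar> * r ^ j"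
      by (intro add_mono mult_left_mono power_mono) (auto simp: r_def)
    finally show ?thesis
      by (simp add: algebra_simps)
  qed
  have decay: "\<bar>x j\<bar> \<le> D * r ^ j" "\<bar>y j\<bar> \<le> D * r ^ j" for j
  proof -
    have "\<bar>x j\<bar> \<le> (\<bar>A * v1\<bar> + \<bar>B * v2\<bar>) * r ^ j" "\<bar>y j\<bar> \<le> (\<bar>A * u1\<bar> + \<bar>B * u2\<bar>) * r ^ j"
      unfolding x_def y_def by (rule mode_le)+
    moreover have "(\<bar>A * v1\<bar> + \<bar>B * v2\<bar>) * r ^ j \<le> D * r ^ j"
      "(\<bar>A * u1\<bar> + \<bar>B * u2\<bar>) * r ^ j \<le> D * r ^ j"
      using r by (auto intro!: mult_right_mono simp: D_def)
    ultimately show "\<bar>x j\<bar> \<le> D * r ^ j" "\<bar>y j\<bar> \<le> D * r ^ j"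
      by linarith+
  qed
  show ?thesis
  proof (cases "x 0 = 0 \<and> y 0 = 0")
    case False
    then show ?thesis
      using that[OF bnd rec1 rec2 decay r] by blast
  next
    \<comment> \<open>A vanishing first block allows a shift by one block: the boundary condition for the shifted
      sequence is then the first instance of the recursion. Two vanishing blocks in a row are excluded by
      the Vandermonde determinant of \<open>w1\<close> and \<open>w2\<close>.\<close>
    case True
    have separate: "k = 0 \<and> l = 0" if "k + l = 0" "k * w1 + l * w2 = 0" for k l :: real
    proof -
      have "l = - k"
        using that by simp
      then have "k * (w1 - w2) = k * w1 + l * w2"
        by (simp add: algebra_simps)
      then show ?thesis
        using w that \<open>l = - k\<close> by simp
    qed
    have "x 1 \<noteq> 0 \<or> y 1 \<noteq> 0"
    proof (rule ccontr)
      assume "\<not> ?thesis"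
      then have "A * v1 = 0 \<and> B * v2 = 0" "A * u1 = 0 \<and> B * u2 = 0"
        using True separate[of "A * v1" "B * v2"] separate[of "A * u1" "B * u2"]
        by (auto simp: x_def y_def)
      then show False
        using AB m1 m2 by auto
    qed
    moreover have "d * x (0 + 1) + c * y (0 + 1) + b * x (1 + 1) + a * y (1 + 1) = 0"
      using rec1[of 0] True by (simp add: numeral_2_eq_2)
    moreover have "\<bar>x (j + 1)\<bar> \<le> (D * r) * r ^ j" "\<bar>y (j + 1)\<bar> \<le> (D * r) * r ^ j" for j
      using decay[of "j + 1"] by (auto simp: mult_ac)
    ultimately show ?thesis
      using rec1[of "_ + 1"] rec2[of "_ + 1"] r
      by (intro that[of "\<lambda>j. x (j + 1)" "\<lambda>j. y (j + 1)" "D * r" r]) auto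
  qed
qed

text \<open>The thresholds 42, 10 and \<open>168 / 17\<close> are the positive \<open>\<rho>\<close> at which a root passes through
  \<open>1\<close> or \<open>- 1\<close>: one has \<open>h 1 = 3360 \<rho> (42 - \<rho>)\<close> and \<open>h (- 1) = (840 - 84 \<rho>) (136 \<rho> - 1344)\<close>.
  As \<open>h 0 < 0\<close>, the intermediate value theorem gives
  one root on each side of zero when both values are positive. For \<open>\<rho> > 42\<close> both are negative, and
  the two roots are separated by the point \<open>1 / 5\<close>, where \<open>h\<close> is positive.\<close>

lemma symbol_determinant_roots:
  fixes \<rho> :: real
  defines "a \<equiv> 9 * \<rho> + 210" and "b \<equiv> 53 * \<rho> + 210" and "c \<equiv> 128 * \<rho> - 672"
    and "d \<equiv> 80 * \<rho>" and "e \<equiv> \<rho> + 42"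
  defines "h \<equiv> symbol_det a b c d e"
  assumes "\<rho> \<in> {168 / 17<..<10} \<union> {42<..}"
  obtains w1 w2 where "h w1 = 0" "h w2 = 0" "w1 \<noteq> w2" "w1 \<noteq> 0" "w2 \<noteq> 0" "\<bar>w1\<bar> < 1" "\<bar>w2\<bar> < 1"
proof -
  have cont: "continuous_on S h" for S
    unfolding h_def symbol_det_def by (intro continuous_intros)
  have \<rho>: "\<rho> > 0"
    using assms(7) by (auto intro: less_trans[rotated])
  have "h 0 = - (28 * \<rho>\<^sup>2 + 1344 * \<rho> + 35280)"
    by (simp add: h_def symbol_det_def a_def b_def e_def power2_eq_square algebra_simps)
  moreover have "28 * \<rho>\<^sup>2 + 1344 * \<rho> + 35280 > 0"
    using \<rho> by (intro add_nonneg_pos add_nonneg_nonneg) auto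
  ultimately have h0: "h 0 < 0"
    by linarith
  have h1: "h 1 = 3360 * \<rho> * (42 - \<rho>)"
    by (simp add: h_def symbol_det_def a_def b_def c_def d_def e_def power2_eq_square algebra_simps)
  consider "168 / 17 < \<rho>" "\<rho> < 10" | "42 < \<rho>"
    using assms(7) by auto
  then show ?thesis
  proof cases
    case 1
    have "h (- 1) = (840 - 84 * \<rho>) * (136 * \<rho> - 1344)"
      by (simp add: h_def symbol_det_def a_def b_def c_def d_def e_def power2_eq_square algebra_simps)
    then have neg: "h (- 1) > 0"
      using 1 by (auto intro!: mult_pos_pos)
    have pos: "h 1 > 0"
      unfolding h1 using 1 \<rho> by auto
    obtain w1 where "- 1 \<le> w1" "w1 \<le> 0" "h w1 = 0"
      using IVT2'[of h 0 0 "- 1"] neg h0 cont by auto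
    moreover obtain w2 where "0 \<le> w2" "w2 \<le> 1" "h w2 = 0"
      using IVT'[of h 0 0 1] pos h0 cont by auto
    moreover have "w \<noteq> 0" "w \<noteq> 1" "w \<noteq> - 1" if "h w = 0" for w
      using that h0 pos neg by auto
    ultimately show ?thesis
      by (intro that[of w1 w2]) (auto simp: abs_if less_le)
  next
    case 2
    have "h (1 / 5) = (61152 * \<rho>\<^sup>2 + 1033536 * \<rho> + 2257920) / 625"
      by (simp add: h_def symbol_det_def a_def b_def c_def d_def e_def power2_eq_square field_simps)
    moreover have "61152 * \<rho>\<^sup>2 + 1033536 * \<rho> + 2257920 > 0"
      using \<rho> by (intro add_nonneg_pos add_nonneg_nonneg) auto
    ultimately have pos: "h (1 / 5) > 0"
      by simp
    have neg: "h 1 < 0"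
      unfolding h1 using 2 by (simp add: mult_pos_neg)
    obtain w1 where "0 \<le> w1" "w1 \<le> 1 / 5" "h w1 = 0"
      using IVT'[of h 0 0 "1 / 5"] pos h0 cont by auto
    moreover obtain w2 where "1 / 5 \<le> w2" "w2 \<le> 1" "h w2 = 0"
      using IVT2'[of h 1 0 "1 / 5"] pos neg cont by auto
    moreover have "w \<noteq> 0" "w \<noteq> 1" "w \<noteq> 1 / 5" if "h w = 0" for w
      using that h0 pos neg by (metis less_irrefl)+
    ultimately show ?thesis
      by (intro that[of w1 w2]) (auto simp: abs_if less_le)
  qed
qed


section \<open>The system matrix\<close>

definition system_block :: "real \<Rightarrow> int \<Rightarrow> real mat" where
  "system_block \<rho> k = - stiffness_block k + \<rho> \<cdot>\<^sub>m mass_block k"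

lemma stiffness_block_carrier [simp]: "stiffness_block k \<in> carrier_mat 2 2"
  by (auto simp: stiffness_block_def mat_of_rows_list_def)

lemma mass_block_carrier [simp]: "mass_block k \<in> carrier_mat 2 2"
  by (auto simp: mass_block_def mat_of_rows_list_def)

lemma system_block_index:
  assumes "p < 2" "q < 2"
  shows "system_block \<rho> k $$ (p, q) = - stiffness_block k $$ (p, q) + \<rho> * mass_block k $$ (p, q)"
  using assms carrier_matD[OF stiffness_block_carrier[of k]] carrier_matD[OF mass_block_carrier[of k]]
  by (simp add: system_block_def)

lemma system_mat_eq_block_toeplitz2: "system_mat N \<rho> = block_toeplitz2 (system_block \<rho>) N"
  by (rule eq_matI)
    (auto simp: system_mat_def stiffness_mat_def mass_mat_def block_toeplitz2_def system_block_index)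

text \<open>Exchanging both the two rows and the two columns turns the block with index \<open>k\<close> into the one with
  index \<open>1 - k\<close>, so five numbers describe all four blocks.\<close>

lemma system_block_entries:
  fixes \<rho> :: real
  defines "a \<equiv> 9 * \<rho> + 210" and "b \<equiv> 53 * \<rho> + 210" and "c \<equiv> 128 * \<rho> - 672"
    and "d \<equiv> 80 * \<rho>" and "e \<equiv> \<rho> + 42"
  shows "system_block \<rho> (- 1) $$ (0, 0) = e / 560" "system_block \<rho> (- 1) $$ (0, 1) = 0"
    "system_block \<rho> (- 1) $$ (1, 0) = a / 560" "system_block \<rho> (- 1) $$ (1, 1) = 0"
    "system_block \<rho> 0 $$ (0, 0) = d / 560" "system_block \<rho> 0 $$ (0, 1) = a / 560"
    "system_block \<rho> 0 $$ (1, 0) = c / 560" "system_block \<rho> 0 $$ (1, 1) = b / 560"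
    "system_block \<rho> 1 $$ (0, 0) = b / 560" "system_block \<rho> 1 $$ (0, 1) = c / 560"
    "system_block \<rho> 1 $$ (1, 0) = a / 560" "system_block \<rho> 1 $$ (1, 1) = d / 560"
    "system_block \<rho> 2 $$ (0, 0) = 0" "system_block \<rho> 2 $$ (0, 1) = a / 560"
    "system_block \<rho> 2 $$ (1, 0) = 0" "system_block \<rho> 2 $$ (1, 1) = e / 560"
  by (simp_all add: system_block_index stiffness_block_def mass_block_def mat_of_rows_list_def
      a_def b_def c_def d_def e_def field_simps)

lemma system_block_outside_band:
  assumes "k < - 1 \<or> k > 2" "p < 2" "q < 2"
  shows "system_block \<rho> k $$ (p, q) = 0"
  using assms by (auto simp: system_block_index stiffness_block_def mass_block_def)

lemma system_block_bounded:
  obtains C where "\<And>k p q. p < 2 \<Longrightarrow> q < 2 \<Longrightarrow> \<bar>system_block \<rho> k $$ (p, q)\<bar> \<le> C"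
proof
  fix k :: int and p q :: nat
  assume pq: "p < 2" "q < 2"
  let ?S = "{- 1..2::int} \<times> {..<2::nat} \<times> {..<2::nat}"
  let ?f = "\<lambda>(k, p, q). \<bar>system_block \<rho> k $$ (p, q)\<bar>"
  show "\<bar>system_block \<rho> k $$ (p, q)\<bar> \<le> sum ?f ?S"
  proof (cases "- 1 \<le> k \<and> k \<le> 2")
    case True
    then show ?thesis
      using pq member_le_sum[of "(k, p, q)" ?S ?f] by auto
  next
    case False
    then show ?thesis
      using pq by (auto simp: system_block_outside_band intro!: sum_nonneg)
  qed
qed

theorem corollary5p7:
  fixes \<rho> :: real
  assumes "\<rho> \<ge> 0"
    and "\<rho> \<in> {168 / 17<..<10} \<union> {42<..}"
  shows "\<exists>c \<alpha> :: real. c > 0 \<and> \<alpha> > 0 \<and>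
    (\<forall>N n :: nat. N \<ge> 1 \<and> n = 2 * N + 1 \<longrightarrow>
      condition_number (system_mat N \<rho>) \<ge> ereal (c * exp (\<alpha> * real n)))"
proof -
  define a b c d e where "a = 9 * \<rho> + 210" and "b = 53 * \<rho> + 210" and "c = 128 * \<rho> - 672"
    and "d = 80 * \<rho>" and "e = \<rho> + 42"
  note entries = system_block_entries[of \<rho>, folded a_def b_def c_def d_def e_def, unfolded One_nat_def]
  obtain w1 w2 where w: "symbol_det a b c d e w1 = 0" "symbol_det a b c d e w2 = 0"
    "w1 \<noteq> w2" "w1 \<noteq> 0" "w2 \<noteq> 0" "\<bar>w1\<bar> < 1" "\<bar>w2\<bar> < 1"
    using symbol_determinant_roots[OF assms(2), folded a_def b_def c_def d_def e_def] .
  obtain x y D r where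
    bnd: "d * x 0 + c * y 0 + b * x 1 + a * y 1 = 0"
    and rec1: "\<And>j. e * x j + a * y j + d * x (j + 1) + c * y (j + 1) + b * x (j + 2) + a * y (j + 2) = 0"
    and rec2: "\<And>j. a * x j + b * y j + c * x (j + 1) + d * y (j + 1) + a * x (j + 2) + e * y (j + 2) = 0"
    and decay: "\<And>j. \<bar>x j\<bar> \<le> D * r ^ j" "\<And>j. \<bar>y j\<bar> \<le> D * r ^ j"
    and r: "0 < r" "r < 1" and start: "x 0 \<noteq> 0 \<or> y 0 \<noteq> 0"
    by (rule decaying_left_null_sequence[OF w]) blast
  define Y where "Y j p = (if p = 0 then x j else y j)" for j p :: nat
  have null: "(\<Sum>i<j + 3. \<Sum>p<2. system_block \<rho> (int i - int j) $$ (p, q) * Y i p) = 0"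
    if q: "q < 2" for j q
  proof -
    let ?\<phi> = "\<lambda>i. \<Sum>p<2. system_block \<rho> (int i - int j) $$ (p, q) * Y i p"
    have \<phi>: "?\<phi> i = system_block \<rho> (int i - int j) $$ (0, q) * x i
        + system_block \<rho> (int i - int j) $$ (1, q) * y i" for i
      by (simp add: Y_def numeral_2_eq_2)
    have q: "q = 0 \<or> q = 1"
      using q by auto
    show ?thesis
    proof (cases j)
      \<comment> \<open>The block with index \<open>- 1\<close> is cut off: column 0 uses the boundary condition, and column 1 has
        no entry in that block.\<close>
      case 0
      have "(\<Sum>i<j + 3. ?\<phi> i) = ?\<phi> 0 + ?\<phi> 1 + ?\<phi> 2"
        using 0 by (simp add: numeral_3_eq_3 numeral_2_eq_2)
      also have "\<dots> = 0"
        using q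
      proof
        assume "q = 0"
        then have "?\<phi> 0 + ?\<phi> 1 + ?\<phi> 2 = (d * x 0 + c * y 0 + b * x 1 + a * y 1) / 560"
          unfolding \<phi> by (simp add: 0 entries add_divide_distrib)
        then show "?\<phi> 0 + ?\<phi> 1 + ?\<phi> 2 = 0"
          unfolding bnd by simp
      next
        assume "q = 1"
        then have "?\<phi> 0 + ?\<phi> 1 + ?\<phi> 2 = (a * x 0 + b * y 0
            + c * x 1 + d * y 1 + a * x 2 + e * y 2) / 560"
          unfolding \<phi> by (simp add: 0 entries add_divide_distrib)
        then show "?\<phi> 0 + ?\<phi> 1 + ?\<phi> 2 = 0"
          unfolding rec2[of 0, unfolded add_0] by simp
      qed
      finally show ?thesis .
    next
      case (Suc m)
      then have j: "j = m + 1"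
        by simp
      have "(\<Sum>i<j + 3. ?\<phi> i) = (\<Sum>i\<in>{m, m + 1, m + 2, m + 3}. ?\<phi> i)"
        using that
        by (intro sum.mono_neutral_right)
          (auto simp: j intro!: sum.neutral disjI1 system_block_outside_band)
      also have "\<dots> = ?\<phi> m + ?\<phi> (m + 1) + ?\<phi> (m + 2) + ?\<phi> (m + 3)"
        by simp
      also have "\<dots> = 0"
        using q
      proof
        assume "q = 0"
        then have "?\<phi> m + ?\<phi> (m + 1) + ?\<phi> (m + 2) + ?\<phi> (m + 3) =
            (e * x m + a * y m + d * x (m + 1) + c * y (m + 1)
            + b * x (m + 2) + a * y (m + 2)) / 560"
          unfolding \<phi> by (simp add: j entries add_divide_distrib)
        then show "?\<phi> m + ?\<phi> (m + 1) + ?\<phi> (m + 2) + ?\<phi> (m + 3) = 0"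
          unfolding rec1 by simp
      next
        assume "q = 1"
        then have "?\<phi> m + ?\<phi> (m + 1) + ?\<phi> (m + 2) + ?\<phi> (m + 3) =
            (a * x (m + 1) + b * y (m + 1) + c * x (m + 1 + 1) + d * y (m + 1 + 1)
            + a * x (m + 1 + 2) + e * y (m + 1 + 2)) / 560"
          unfolding \<phi> by (simp add: j entries add_divide_distrib numeral_2_eq_2 numeral_3_eq_3)
        then show "?\<phi> m + ?\<phi> (m + 1) + ?\<phi> (m + 2) + ?\<phi> (m + 3) = 0"
          unfolding rec2 by simp
      qed
      finally show ?thesis .
    qed
  qed
  obtain C where C: "\<And>k p q. p < 2 \<Longrightarrow> q < 2 \<Longrightarrow> \<bar>system_block \<rho> k $$ (p, q)\<bar> \<le> C"
    using system_block_bounded[of \<rho>] by metis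
  obtain p0 :: nat where "p0 < 2" "Y 0 p0 \<noteq> 0"
    using start unfolding Y_def by (metis one_less_numeral_iff pos2 semiring_norm(76) zero_neq_one)
  moreover have "system_block \<rho> 0 $$ (0, 0) \<noteq> 0"
    using assms(2) by (auto simp: entries d_def)
  ultimately have "\<exists>c \<alpha>. c > 0 \<and> \<alpha> > 0 \<and> (\<forall>N\<ge>1.
    condition_number (block_toeplitz2 (system_block \<rho>) N) \<ge> ereal (c * exp (\<alpha> * real (2 * N + 1))))"
    using C null decay r
    by (intro condition_number_block_toeplitz2_exp_growth[of "system_block \<rho>" C Y D r])
      (auto simp: system_block_outside_band Y_def)
  then show ?thesis
    by (auto simp: system_mat_eq_block_toeplitz2)
qed

end
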